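(* Fix an integer $d \ge 2$, and let $\mathcal K(d)$ be the nonnegative-integer-valued random variable defined in the context. Then, as $k \to \infty$, $$\mathbb P(\mathcal K(d) \ge k) \le \exp\left[-\Omega\left(k^{1/[d+2-(d-1)^{-1}]}\right)\right];$$ that is, there exist constants $c = c(d) > 0$ and $k_0 = k_0(d)$ such that $\mathbb P(\mathcal K(d) \ge k) \le \exp\left[-c\, k^{1/[d+2-(d-1)^{-1}]}\right]$ for all integers $k \ge k_0$.
   Context: For $\mathbf x, \mathbf y \in \mathbb R^d$, $\mathbf x \prec \mathbf y$ (equivalently $\mathbf y \succ \mathbf x$; "$\mathbf x$ is dominated by $\mathbf y$") means $x_j < y_j$ for every $j$; $z_+ := \sum_{j=1}^d z_j$. A point $\mathbf y$ of a point process $S$ is a maximum of $S$ if $\mathbf y \not\prec \mathbf z$ for all points $\mathbf z$ of $S$. Definition of $\mathcal K(d)$: for $g \in \mathbb R$ let $\mathbf x(g) := (g/d,\dots,g/d) \in \mathbb R^d$ and let $\mathcal K_g$ be the number of maxima dominated by $\mathbf x(g)$ in a nonhomogeneous Poisson point process in $\mathbb R^d$ with intensity function $\mathbf z \mapsto \mathbf 1(\mathbf z \not\succ \mathbf x(g))\, e^{-z_+}$. The law of $\mathcal K(d)$ is the mixture $\mathbb E\,\mathcal L(\mathcal K_G)$ with $G$ standard Gumbel, i.e. $\mathbb P(\mathcal K(d) \ge k) = \int_{-\infty}^\infty \mathbb P(\mathcal K_g \ge k)\, e^{-g}\exp(-e^{-g})\,dg$. *)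

theory Defs
  imports "HOL-Probability.Probability"
begin

definition dominated :: "real^'n \<Rightarrow> real^'n \<Rightarrow> bool" where
  "dominated x y \<longleftrightarrow> (\<forall>j. x $ j < y $ j)"

definition coord_sum :: "real^'n \<Rightarrow> real" where
  "coord_sum z = (\<Sum>j\<in>UNIV. z $ j)"

definition maxima :: "(real^'n) set \<Rightarrow> (real^'n) set" where
  "maxima S = {y \<in> S. \<not> (\<exists>z\<in>S. dominated y z)}"

text \<open>
  Point processes are described by their laws, which are probability measures on the space
  of locally finite point configurations.  Configurations are sets, that is, points have no
  multiplicities; this is no restriction for Poisson processes with a diffuse intensity measure,
  which are almost surely simple.
\<close>

definition configurations :: "'a::euclidean_space set set" where
  "configurations = {S. \<forall>B. bounded B \<longrightarrow> finite (S \<inter> B)}"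

text \<open>Cardinality with values in \<^typ>\<open>ennreal\<close>, so that infinite sets are counted as infinite.\<close>

definition num_points :: "'a set \<Rightarrow> ennreal" where
  "num_points A = emeasure (count_space UNIV) A"

definition configuration_space :: "'a::euclidean_space set measure" where
  "configuration_space = sigma configurations
     {{S \<in> configurations. num_points (S \<inter> B) = of_nat n} | B n. B \<in> sets borel}"

text \<open>
  Independence over finitely many disjoint sets is covered by sequences that are eventually
  empty.  The Poisson probabilities are written out because the rate may be \<open>0\<close>, which
  \<^const>\<open>poisson_pmf\<close> does not cover.
\<close>

definition poisson_process_law :: "'a::euclidean_space measure \<Rightarrow> 'a set measure \<Rightarrow> bool" where
  "poisson_process_law \<Lambda> P \<longleftrightarrow>
     prob_space P \<and>
     space P = configurations \<and>
     sets P = sets configuration_space \<and>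
     (\<forall>B\<in>sets borel. emeasure \<Lambda> B < \<infinity> \<longrightarrow>
        (\<forall>n::nat. measure P {S \<in> space P. num_points (S \<inter> B) = of_nat n} =
           exp (- measure \<Lambda> B) * measure \<Lambda> B ^ n / fact n)) \<and>
     (\<forall>B::nat \<Rightarrow> 'a set. range B \<subseteq> sets borel \<and> disjoint_family B \<longrightarrow>
        prob_space.indep_vars P (\<lambda>_. borel) (\<lambda>i S. num_points (S \<inter> B i)) UNIV)"

definition diag_point :: "real \<Rightarrow> real^'n" where
  "diag_point g = (\<chi> j. g / real CARD('n))"

definition intensity :: "real \<Rightarrow> (real^'n) measure" where
  "intensity g = density lborel
     (\<lambda>z. indicator {z. \<not> dominated (diag_point g) z} z * ennreal (exp (- coord_sum z)))"

definition num_dominated_maxima :: "real \<Rightarrow> (real^'n) set \<Rightarrow> ennreal" where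
  "num_dominated_maxima g S = num_points {y \<in> maxima S. dominated y (diag_point g)}"

definition gumbel_density :: "real \<Rightarrow> real" where
  "gumbel_density g = exp (- g) * exp (- exp (- g))"

text \<open>
  \<open>K_tail P k\<close> is the probability that \<open>K(d)\<close> is at least \<open>k\<close>, where \<open>P g\<close> is the law
  of the Poisson process with intensity measure \<open>intensity g\<close> and \<open>d = CARD('n)\<close>.
\<close>

definition K_tail :: "(real \<Rightarrow> (real^'n) set measure) \<Rightarrow> nat \<Rightarrow> real" where
  "K_tail P k = (\<integral>g. measure (P g) {S \<in> space (P g). of_nat k \<le> num_dominated_maxima g S}
                       * gumbel_density g \<partial>lborel)"

end

theory Submission
  imports Defs "HOL-Real_Asymp.Real_Asymp"
begin

text \<open>
  Put \<open>d = CARD('n)\<close> and let \<open>T\<close> be a small multiple of \<open>k powr (1 / D)\<close>, where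
  \<open>D = d + 2 - 1 / (d - 1) \<ge> d + 1\<close>.  A Gumbel variable lies outside \<open>[- ln T, T]\<close> with
  probability at most \<open>2 exp (- T)\<close>, so \<open>g\<close> may be taken inside.  Choose \<open>s\<close> with
  \<open>exp (- g) * (exp s - 1) = T\<close>; then \<open>s \<le> 2 T\<close>.  For \<open>v \<ge> 0\<close> of coordinate sum at least \<open>s\<close>, the
  intensity measure of the orthant above \<open>x(g) - v\<close> is at least \<open>T\<close>, so that orthant is empty with
  probability at most \<open>exp (- T)\<close>.  Over the polynomially many such \<open>v\<close> in a grid of spacing \<open>1 / d\<close>
  a union bound shows that, up to probability \<open>poly T * exp (- T)\<close>, all these orthants contain points.
  Then every maximum dominated by \<open>x(g)\<close> lies in a simplex of size \<open>s + 1\<close> below \<open>x(g)\<close>.  The intensity measure of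
  this simplex is \<open>O (T ^ (d + 1))\<close>, at most \<open>k / 4\<close>, and by Chernoff's bound it contains \<open>k\<close> points only
  with probability \<open>exp (- k / 2)\<close>.
\<close>

section \<open>Chernoff's bound for the Poisson distribution\<close>

text \<open>Replacing \<open>m\<close> by \<open>exp 1 * m\<close> multiplies the term of index
  \<open>n + k\<close> by \<open>exp (n + k)\<close>, which is at least \<open>exp k\<close>. So the
  tail at \<open>m\<close> is at most \<open>exp (- k)\<close> times the tail at
  \<open>exp 1 * m\<close>.\<close>

lemma exp_tail_le:
  fixes m :: real
  assumes "m \<ge> 0"
  shows "exp m - (\<Sum>n<k. m ^ n / fact n) \<le> exp (exp 1 * m - real k)"
proof -
  define f where "f = (\<lambda>x n. x ^ n / fact n :: real)"
  have sums: "f x sums exp x" for x :: real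
    using exp_converges[of x] by (simp add: f_def divide_inverse mult.commute)
  have shift: "(\<lambda>n. f x (n + k)) sums (exp x - (\<Sum>n<k. f x n))" for x
    using sums by (subst sums_iff_shift) simp
  have "f m (n + k) \<le> exp (- real k) * f (exp 1 * m) (n + k)" for n
  proof -
    have "1 \<le> exp (real n)"
      by simp
    also have "\<dots> = exp (- real k) * exp 1 ^ (n + k)"
      by (simp flip: exp_of_nat_mult exp_add)
    finally have "1 \<le> exp (- real k) * exp 1 ^ (n + k)" .
    from mult_right_mono[OF this, of "m ^ (n + k)"] assms show ?thesis
      by (simp add: f_def divide_right_mono power_mult_distrib mult.assoc)
  qed
  then have "exp m - (\<Sum>n<k. f m n)
      \<le> exp (- real k) * (exp (exp 1 * m) - (\<Sum>n<k. f (exp 1 * m) n))"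
    by (rule sums_le[OF _ shift sums_mult[OF shift]])
  also have "\<dots> \<le> exp (- real k) * exp (exp 1 * m)"
    using assms by (intro mult_left_mono) (auto intro!: sum_nonneg simp: f_def)
  finally show ?thesis
    by (simp add: f_def flip: exp_add)
qed

text \<open>The factor \<open>exp (- m)\<close> turns the exponent into
  \<open>(exp 1 - 1) * m - k\<close>, and \<open>exp 1 \<le> 3\<close> gives the 2.\<close>

lemma poisson_tail_le:
  fixes m :: real
  assumes "m \<ge> 0"
  shows "1 - (\<Sum>n<k. exp (- m) * m ^ n / fact n) \<le> exp (2 * m - real k)"
proof -
  have "1 - (\<Sum>n<k. exp (- m) * m ^ n / fact n) = exp (- m) * (exp m - (\<Sum>n<k. m ^ n / fact n))"
    by (simp add: right_diff_distrib sum_distrib_left flip: exp_add)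
  also have "\<dots> \<le> exp (- m) * exp (exp 1 * m - real k)"
    using exp_tail_le[OF assms] by (intro mult_left_mono) auto
  also have "\<dots> \<le> exp (2 * m - real k)"
    using mult_right_mono[OF exp_le assms] by (simp flip: exp_add)
  finally show ?thesis .
qed

section \<open>Intensity measure of orthants\<close>

lemma sum_Basis_vec:
  fixes f :: "real^'n \<Rightarrow> real"
  shows "(\<Sum>b\<in>Basis. f b) = (\<Sum>i\<in>UNIV. f (axis i 1))"
proof -
  have Basis: "(Basis :: (real^'n) set) = range (\<lambda>i. axis i 1)"
    by (auto simp: Basis_vec_def)
  show ?thesis
    unfolding Basis by (subst sum.reindex) (auto simp: inj_on_def axis_eq_axis)
qed

lemma coord_sum_Basis: "coord_sum z = (\<Sum>b\<in>Basis. z \<bullet> b)"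
  by (simp add: sum_Basis_vec coord_sum_def inner_axis)

lemma dominated_Basis: "dominated x y \<longleftrightarrow> (\<forall>b\<in>Basis. x \<bullet> b < y \<bullet> b)"
  by (force simp: dominated_def Basis_vec_def inner_axis)

lemma nn_integral_exp_greaterThan:
  "(\<integral>\<^sup>+t. ennreal (indicator {a<..} t * exp (- t)) \<partial>lborel) = ennreal (exp (- a))"
proof -
  have "(\<integral>\<^sup>+t. ennreal (indicator {a<..} t * exp (- t)) \<partial>lborel)
      = (\<integral>\<^sup>+t. ennreal (exp (- t)) * indicator {a..} t \<partial>lborel)"
    \<comment> \<open>The open and the closed ray differ by a null set; the fundamental theorem of
      calculus is applied on the closed one.\<close>
    using AE_lborel_singleton[of a]
    by (intro nn_integral_cong_AE) (auto elim!: eventually_mono split: split_indicator)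
  also have "\<dots> = ennreal (0 - (- exp (- a)))"
  proof (rule nn_integral_FTC_atLeast)
    show "((\<lambda>t. - exp (- t :: real)) \<longlongrightarrow> 0) at_top"
      using tendsto_minus[OF filterlim_compose[OF exp_at_bot filterlim_uminus_at_bot_at_top]] by simp
  qed (auto intro!: derivative_eq_intros)
  finally show ?thesis by simp
qed

lemma borel_measurable_coord_sum [measurable]: "coord_sum \<in> borel_measurable borel"
  unfolding coord_sum_Basis[abs_def] by measurable

lemma pred_dominated [measurable]:
  "Measurable.pred borel (dominated (a :: real^'n))" "Measurable.pred borel (\<lambda>z. dominated z (a :: real^'n))"
  unfolding dominated_Basis by measurable

text \<open>Both the density and the indicator of the orthant factor over coordinates, so the
  integral is a product of exponential tails.\<close>

lemma emeasure_orthant: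
  fixes a :: "real^'n"
  shows "emeasure (density lborel (\<lambda>z. ennreal (exp (- coord_sum z)))) {z. dominated a z}
    = ennreal (exp (- coord_sum a))"
proof -
  have "emeasure (density lborel (\<lambda>z. ennreal (exp (- coord_sum z)))) {z. dominated a z}
      = (\<integral>\<^sup>+z. (\<Prod>b\<in>Basis. ennreal (indicator {a \<bullet> b<..} (z \<bullet> b) * exp (- (z \<bullet> b)))) \<partial>lborel)"
  proof (subst emeasure_density; (simp; fail)?)
    have "ennreal (exp (- coord_sum z)) * indicator {z. dominated a z} z
        = (\<Prod>b\<in>Basis. ennreal (indicator {a \<bullet> b<..} (z \<bullet> b) * exp (- (z \<bullet> b))))" for z
    proof (cases "dominated a z")
      case True
      then show ?thesis
        by (simp add: prod_ennreal dominated_Basis coord_sum_Basis exp_sum flip: sum_negf)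
    next
      case False
      then have "\<exists>b\<in>Basis. ennreal (indicator {a \<bullet> b<..} (z \<bullet> b) * exp (- (z \<bullet> b))) = 0"
        by (force simp: dominated_Basis)
      then have "(\<Prod>b\<in>Basis. ennreal (indicator {a \<bullet> b<..} (z \<bullet> b) * exp (- (z \<bullet> b)))) = 0"
        by (intro prod_zero) auto
      with False show ?thesis by simp
    qed
    then show "(\<integral>\<^sup>+z. ennreal (exp (- coord_sum z)) * indicator {z. dominated a z} z \<partial>lborel)
      = (\<integral>\<^sup>+z. (\<Prod>b\<in>Basis. ennreal (indicator {a \<bullet> b<..} (z \<bullet> b) * exp (- (z \<bullet> b)))) \<partial>lborel)"
      by simp
  qed
  also have "\<dots> = (\<Prod>b\<in>Basis. \<integral>\<^sup>+t. ennreal (indicator {a \<bullet> b<..} t * exp (- t)) \<partial>lborel)"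
    by (rule nn_integral_lborel_prod) auto
  also have "\<dots> = ennreal (exp (- coord_sum a))"
    by (simp add: nn_integral_exp_greaterThan prod_ennreal coord_sum_Basis exp_sum flip: sum_negf)
  finally show ?thesis .
qed

lemma coord_sum_diag_point_minus: "coord_sum (diag_point g - v) = g - coord_sum v"
  by (simp add: coord_sum_def diag_point_def sum_subtractf)

text \<open>For \<open>v \<ge> 0\<close> this orthant contains the one above
  \<open>diag_point g\<close>, where the intensity vanishes. The mass is thus a difference of two
  orthant masses, \<open>exp (coord_sum v - g) - exp (- g)\<close>.\<close>

lemma emeasure_intensity_shifted_orthant:
  fixes v :: "real^'n"
  assumes "\<And>j. v $ j \<ge> 0"
  shows "emeasure (intensity g) {z. dominated (diag_point g - v) z}
    = ennreal (exp (- g) * (exp (coord_sum v) - 1))"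
proof -
  let ?M = "density lborel (\<lambda>z :: real^'n. ennreal (exp (- coord_sum z)))"
  let ?B = "{z. dominated (diag_point g - v) z}" and ?C = "{z. dominated (diag_point g) z}"
  have sub: "?C \<subseteq> ?B"
    using assms by (auto simp: dominated_def) (smt (verit))
  have sets: "?B \<in> sets borel" "?C \<in> sets borel"
    by measurable
  have "emeasure (intensity g) ?B = emeasure ?M (?B - ?C)"
    using sets by (simp add: intensity_def emeasure_density del: vector_minus_component)
      (intro nn_integral_cong, auto split: split_indicator)
  also have "\<dots> = emeasure ?M ?B - emeasure ?M ?C"
    using sub sets by (intro emeasure_Diff) (auto simp: emeasure_orthant)
  also have "\<dots> = ennreal (exp (- g) * (exp (coord_sum v) - 1))"
    \<comment> \<open>The instance at 0 says that \<open>diag_point g\<close> has coordinate sum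
      \<open>g\<close>.\<close>
    using coord_sum_diag_point_minus[of g "0 :: real^'n"]
    by (simp add: emeasure_orthant coord_sum_diag_point_minus coord_sum_def[of 0] right_diff_distrib
      ennreal_minus flip: exp_add)
  finally show ?thesis .
qed

section \<open>The Gumbel mixture\<close>

lemma gumbel_nonneg: "gumbel_density g \<ge> 0"
  by (simp add: gumbel_density_def)

text \<open>The antiderivative is the Gumbel distribution function \<open>exp (- exp (- g))\<close>.
  Extended real endpoints treat half-lines and the whole line at once.\<close>

lemma gumbel_interval:
  fixes a b :: ereal
  assumes "a < b"
    and "(((\<lambda>g. exp (- exp (- g))) \<circ> real_of_ereal) \<longlongrightarrow> A) (at_right a)"
    and "(((\<lambda>g. exp (- exp (- g))) \<circ> real_of_ereal) \<longlongrightarrow> B) (at_left b)"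
  shows "integrable lborel (\<lambda>g. indicator (einterval a b) g * gumbel_density g)"
    and "(\<integral>g. indicator (einterval a b) g * gumbel_density g \<partial>lborel) = B - A"
proof -
  let ?F = "\<lambda>g :: real. exp (- exp (- g))"
  have "DERIV ?F g :> gumbel_density g" for g
    by (auto intro!: derivative_eq_intros simp: gumbel_density_def)
  moreover have "isCont gumbel_density g" for g
    unfolding gumbel_density_def[abs_def] by (intro continuous_intros)
  moreover note interval_integral_FTC_nonneg[of a b ?F gumbel_density A B]
  ultimately show "integrable lborel (\<lambda>g. indicator (einterval a b) g * gumbel_density g)"
    and "(\<integral>g. indicator (einterval a b) g * gumbel_density g \<partial>lborel) = B - A"
    using assms gumbel_nonneg less_imp_le[OF \<open>a < b\<close>]
    by (auto simp: set_integrable_def interval_lebesgue_integral_def set_lebesgue_integral_def)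
qed

lemma gumbel_lim_PInf: "(((\<lambda>g. exp (- exp (- g))) \<circ> real_of_ereal) \<longlongrightarrow> 1) (at_left \<infinity>)"
proof -
  have "((\<lambda>g :: real. exp (- exp (- g))) \<longlongrightarrow> exp (- 0)) at_top"
    by (intro tendsto_intros filterlim_compose[OF exp_at_bot] filterlim_uminus_at_bot_at_top)
  then show ?thesis
    by (simp add: ereal_tendsto_simps)
qed

lemma gumbel_lim_MInf: "(((\<lambda>g. exp (- exp (- g))) \<circ> real_of_ereal) \<longlongrightarrow> 0) (at_right (- \<infinity>))"
proof -
  have "((\<lambda>g :: real. exp (- exp (- g))) \<longlongrightarrow> 0) at_bot"
    by (intro filterlim_compose[OF exp_at_bot] filterlim_compose[OF filterlim_uminus_at_bot_at_top]
      filterlim_compose[OF exp_at_top] filterlim_uminus_at_top_at_bot)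
  then show ?thesis
    by (simp add: ereal_tendsto_simps)
qed

lemma gumbel_lim_ereal:
  "(((\<lambda>g. exp (- exp (- g))) \<circ> real_of_ereal) \<longlongrightarrow> exp (- exp (- a))) (at_right (ereal a))"
  "(((\<lambda>g. exp (- exp (- g))) \<circ> real_of_ereal) \<longlongrightarrow> exp (- exp (- a))) (at_left (ereal a))"
  by (auto simp: ereal_tendsto_simps intro!: tendsto_intros)

lemma gumbel_mixture_le:
  fixes p :: "real \<Rightarrow> real"
  assumes p: "\<And>g. p g \<le> 1" "\<And>g. a \<le> g \<Longrightarrow> g \<le> b \<Longrightarrow> p g \<le> q" and "q \<ge> 0"
  shows "(\<integral>g. p g * gumbel_density g \<partial>lborel) \<le> exp (- exp (- a)) + exp (- b) + q"
proof -
  have 1: "(\<lambda>g. indicator {..<a} g * gumbel_density g) = (\<lambda>g. indicator (einterval (-\<infinity>) a) g * gumbel_density g)"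
    and 2: "(\<lambda>g. indicator {b<..} g * gumbel_density g) = (\<lambda>g. indicator (einterval b \<infinity>) g * gumbel_density g)"
    and 3: "gumbel_density = (\<lambda>g. indicator (einterval (-\<infinity>) \<infinity>) g * gumbel_density g)"
    by (auto simp: einterval_def fun_eq_iff split: split_indicator)
  \<comment> \<open>The Gumbel masses are \<open>exp (- exp (- a))\<close> below \<open>a\<close>,
    \<open>1 - exp (- exp (- b))\<close> above \<open>b\<close>, and 1 in total.\<close>
  note left = gumbel_interval[OF _ gumbel_lim_MInf gumbel_lim_ereal(2), of a, folded 1, simplified]
  note right = gumbel_interval[OF _ gumbel_lim_ereal(1) gumbel_lim_PInf, of b, folded 2, simplified]
  note all = gumbel_interval[OF _ gumbel_lim_MInf gumbel_lim_PInf, folded 3, simplified]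
  let ?h = "\<lambda>g. indicator {..<a} g * gumbel_density g + indicator {b<..} g * gumbel_density g
    + q * gumbel_density g"
  have "(\<integral>g. p g * gumbel_density g \<partial>lborel) \<le> (\<integral>g. ?h g \<partial>lborel)"
  \<comment> \<open>If the left integrand is not integrable, its integral is 0 by convention, and
    the nonnegativity of \<open>?h\<close> still gives the inequality.\<close>
  proof (rule integral_mono')
    fix g
    have "p g \<le> indicator {..<a} g + indicator {b<..} g + q"
      using p(1)[of g] p(2)[of g] \<open>q \<ge> 0\<close> by (auto split: split_indicator)
    from mult_right_mono[OF this gumbel_nonneg]
    show "p g * gumbel_density g \<le> ?h g"
      by (simp add: algebra_simps)
    show "0 \<le> ?h g"
      using gumbel_nonneg \<open>q \<ge> 0\<close> by simp
  qed (use left right all in simp)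
  also have "\<dots> = exp (- exp (- a)) + (1 - exp (- exp (- b))) + q"
    using left right all by simp
  also have "\<dots> \<le> exp (- exp (- a)) + exp (- b) + q"
    using exp_ge_add_one_self[of "- exp (- b)"] by simp
  finally show ?thesis .
qed

section \<open>Intensity measure of the simplex below the diagonal point\<close>

text \<open>On the simplex the density is at most \<open>exp (t - g)\<close>. Each coordinate of
  \<open>diag_point g - y\<close> is nonnegative, hence at most their sum, so a cube of side
  \<open>t\<close> contains the simplex.\<close>

lemma emeasure_intensity_simplex_le:
  fixes g t :: real
  assumes "t \<ge> 0"
  shows "emeasure (intensity g) {y :: real^'n. dominated y (diag_point g) \<and> g - coord_sum y < t}
    \<le> ennreal (exp (t - g) * t ^ CARD('n))"
proof -
  let ?A = "{y :: real^'n. dominated y (diag_point g) \<and> g - coord_sum y < t}"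
  let ?x = "diag_point g :: real^'n"
  let ?C = "cbox (?x - t *\<^sub>R (\<Sum>b\<in>Basis. b)) ?x"
  have sub: "?A \<subseteq> ?C"
  proof
    fix y assume y: "y \<in> ?A"
    have sum: "coord_sum (?x - y) = g - coord_sum y"
      by (rule coord_sum_diag_point_minus)
    have "(?x - y) \<bullet> b \<le> coord_sum (?x - y)" if "b \<in> Basis" for b
      unfolding coord_sum_Basis using y that
      by (intro member_le_sum) (auto simp: dominated_Basis inner_diff_left less_imp_le)
    with y sum show "y \<in> ?C"
      by (force simp: mem_box dominated_Basis inner_diff_left less_imp_le inner_sum_left_Basis)
  qed
  have A: "?A \<in> sets borel"
    by measurable
  have "emeasure (intensity g) ?A \<le> (\<integral>\<^sup>+y. ennreal (exp (t - g)) * indicator ?C y \<partial>lborel)"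
    using A sub unfolding intensity_def
    by (subst emeasure_density) (auto intro!: nn_integral_mono ennreal_leI split: split_indicator)
  also have "\<dots> = ennreal (exp (t - g)) * emeasure lborel ?C"
    by (simp add: nn_integral_cmult_indicator)
  also have "emeasure lborel ?C = ennreal (t ^ CARD('n))"
    using assms by (subst emeasure_lborel_cbox) (auto simp: inner_diff_left inner_sum_left_Basis)
  finally show ?thesis
    using assms by (simp add: ennreal_mult)
qed

section \<open>Counts and void probabilities of Poisson processes\<close>

lemma sets_num_points_eq:
  assumes "poisson_process_law \<Lambda> P" "B \<in> sets borel"
  shows "{S \<in> space P. num_points (S \<inter> B) = of_nat n} \<in> sets P"
proof -
  let ?G = "{{S \<in> configurations. num_points (S \<inter> B) = of_nat n} | B n. B \<in> sets borel}"
  \<comment> \<open>\<open>sigma\<close> is the generated sigma-algebra only if the generators are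
    subsets of the space.\<close>
  have "?G \<subseteq> Pow (configurations :: 'a set set)"
    by auto
  then have "sets configuration_space = sigma_sets (configurations :: 'a set set) ?G"
    by (simp add: configuration_space_def)
  then show ?thesis
    using assms by (auto simp: poisson_process_law_def intro!: sigma_sets.Basic)
qed

lemma measure_num_points_eq:
  assumes "poisson_process_law \<Lambda> P" "B \<in> sets borel" "emeasure \<Lambda> B < \<infinity>"
  shows "measure P {S \<in> space P. num_points (S \<inter> B) = of_nat n} =
    exp (- measure \<Lambda> B) * measure \<Lambda> B ^ n / fact n"
  using assms unfolding poisson_process_law_def by blast

text \<open>Counts are natural numbers or infinity, so a tail event is the complement of finitely
  many events of the form covered by the Poisson law.\<close>

lemma num_points_ge_iff:
  "of_nat k \<le> num_points A \<longleftrightarrow> (\<forall>n<k. num_points A \<noteq> of_nat n)"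
proof (cases "finite A")
  case True
  then show ?thesis
    by (auto simp: num_points_def emeasure_count_space) (metis linorder_not_le)
qed (auto simp: num_points_def)

text \<open>The bound \<open>exp (2 * m - k)\<close> increases with the mean, so an upper estimate
  \<open>m\<close> of the intensity measure suffices.\<close>

lemma poisson_process_tail_le:
  assumes P: "poisson_process_law \<Lambda> P" and B: "B \<in> sets borel"
    and m: "emeasure \<Lambda> B \<le> ennreal m" "m \<ge> 0"
  shows "{S \<in> space P. of_nat k \<le> num_points (S \<inter> B)} \<in> sets P"
    and "measure P {S \<in> space P. of_nat k \<le> num_points (S \<inter> B)} \<le> exp (2 * m - real k)"
proof -
  interpret prob_space P
    using P by (simp add: poisson_process_law_def)
  let ?E = "\<lambda>n. {S \<in> space P. num_points (S \<inter> B) = of_nat n}"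
  have E: "?E n \<in> sets P" for n
    by (rule sets_num_points_eq[OF P B])
  have eq: "{S \<in> space P. of_nat k \<le> num_points (S \<inter> B)} = space P - (\<Union>n<k. ?E n)"
    by (auto simp: num_points_ge_iff)
  show "{S \<in> space P. of_nat k \<le> num_points (S \<inter> B)} \<in> sets P"
    unfolding eq using E by auto
  have fin: "emeasure \<Lambda> B < \<infinity>"
    using m by (auto intro: le_less_trans)
  have "measure \<Lambda> B \<le> m"
    using m unfolding measure_def by (metis enn2real_leI)
  have "prob (\<Union>n<k. ?E n) = (\<Sum>n<k. prob (?E n))"
    using E by (intro finite_measure_finite_Union) (auto simp: disjoint_family_on_def)
  also have "\<dots> = (\<Sum>n<k. exp (- measure \<Lambda> B) * measure \<Lambda> B ^ n / fact n)"
    by (intro sum.cong refl measure_num_points_eq[OF P B fin])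
  finally have "prob {S \<in> space P. of_nat k \<le> num_points (S \<inter> B)}
      = 1 - (\<Sum>n<k. exp (- measure \<Lambda> B) * measure \<Lambda> B ^ n / fact n)"
    unfolding eq using E by (subst prob_compl) auto
  also have "\<dots> \<le> exp (2 * measure \<Lambda> B - real k)"
    by (rule poisson_tail_le) simp
  also have "\<dots> \<le> exp (2 * m - real k)"
    using \<open>measure \<Lambda> B \<le> m\<close> by simp
  finally show "prob {S \<in> space P. of_nat k \<le> num_points (S \<inter> B)} \<le> exp (2 * m - real k)" .
qed

lemma poisson_process_void_eq:
  assumes P: "poisson_process_law \<Lambda> P" and B: "B \<in> sets borel"
    and m: "emeasure \<Lambda> B = ennreal m" "m \<ge> 0"
  shows "{S \<in> space P. S \<inter> B = {}} \<in> sets P"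
    and "measure P {S \<in> space P. S \<inter> B = {}} = exp (- m)"
proof -
  have "num_points A = of_nat 0 \<longleftrightarrow> A = {}" for A :: "'a set"
    by (simp add: num_points_def emeasure_count_space_eq_0)
  then have eq: "{S \<in> space P. S \<inter> B = {}} = {S \<in> space P. num_points (S \<inter> B) = of_nat 0}"
    by simp
  show "{S \<in> space P. S \<inter> B = {}} \<in> sets P"
    unfolding eq by (rule sets_num_points_eq[OF P B])
  have fin: "emeasure \<Lambda> B < \<infinity>" and "measure \<Lambda> B = m"
    using m by (auto simp: measure_def)
  with measure_num_points_eq[OF P B fin, of 0] show "measure P {S \<in> space P. S \<inter> B = {}} = exp (- m)"
    unfolding eq by simp
qed

section \<open>Localising the dominated maxima by a grid of orthants\<close>

text \<open>Rounding \<open>d\<close> coordinates down to multiples of \<open>1 / d\<close> lowers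
  their sum by at most 1, from \<open>s + 1\<close> to no less than \<open>s\<close>. The bound on
  \<open>f\<close> leaves finitely many grid points for the union bound.\<close>

lemma simplex_grid_point:
  fixes u :: "real^'n"
  assumes u: "\<And>j. u $ j \<ge> 0" "coord_sum u \<ge> s + 1" and "s \<ge> 0"
  obtains f :: "'n \<Rightarrow> nat" where
    "\<And>j. f j \<le> nat \<lfloor>real CARD('n) * (s + 1)\<rfloor>"
    "\<And>j. real (f j) / real CARD('n) \<le> u $ j"
    "coord_sum (\<chi> j. real (f j) / real CARD('n) :: real^'n) \<ge> s"
proof
  let ?d = "real CARD('n)"
  have d: "?d > 0"
    by simp
  \<comment> \<open>Shrinking \<open>u\<close> onto the simplex of size \<open>s + 1\<close> bounds its coordinates before rounding down.\<close>
  define r where "r = (s + 1) / coord_sum u"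
  have r: "0 \<le> r" "r \<le> 1" "r * coord_sum u = s + 1"
    using u(2) \<open>s \<ge> 0\<close> by (auto simp: r_def)
  define f where "f = (\<lambda>j. nat \<lfloor>?d * (r * u $ j)\<rfloor>)"
  have f: "real (f j) \<le> ?d * (r * u $ j)" "?d * (r * u $ j) \<le> real (f j) + 1" for j
    unfolding f_def using u(1)[of j] r(1) by (simp, linarith)
  show "f j \<le> nat \<lfloor>?d * (s + 1)\<rfloor>" for j
  proof -
    have "u $ j \<le> coord_sum u"
      unfolding coord_sum_def using u(1) by (intro member_le_sum) auto
    then have "r * u $ j \<le> s + 1"
      using mult_left_mono[OF _ r(1)] r(3) by metis
    then show ?thesis
      unfolding f_def by (intro nat_mono floor_mono mult_left_mono) auto
  qed
  show "real (f j) / ?d \<le> u $ j" for j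
  proof -
    have "real (f j) \<le> ?d * (r * u $ j)"
      by (rule f)
    also have "\<dots> \<le> ?d * u $ j"
      using mult_right_mono[OF r(2) u(1)[of j]] by (intro mult_left_mono) auto
    finally show ?thesis
      using d by (simp add: field_simps)
  qed
  have "s + 1 = (\<Sum>j\<in>UNIV. r * u $ j)"
    using r(3) by (simp add: coord_sum_def sum_distrib_left)
  also have "\<dots> \<le> (\<Sum>j\<in>UNIV. real (f j) / ?d + 1 / ?d)"
    using f(2) d by (intro sum_mono) (simp add: field_simps)
  also have "\<dots> = coord_sum (\<chi> j. real (f j) / ?d :: real^'n) + 1"
    by (simp add: coord_sum_def sum.distrib)
  finally show "coord_sum (\<chi> j. real (f j) / ?d :: real^'n) \<ge> s"
    by simp
qed

text \<open>The first term bounds the probability that some grid orthant is empty, the second that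
  the simplex holds at least \<open>k\<close> points. If no grid orthant is empty, all dominated
  maxima lie in the simplex.\<close>

lemma prob_dominated_maxima_le:
  fixes P :: "(real^'n) set measure"
  assumes P: "poisson_process_law (intensity g) P"
    and s: "s \<ge> 0" "exp (- g) * (exp s - 1) \<ge> R"
  shows "measure P {S \<in> space P. of_nat k \<le> num_dominated_maxima g S}
    \<le> (real CARD('n) * (s + 1) + 1) ^ CARD('n) * exp (- R)
      + exp (2 * (exp (s + 1 - g) * (s + 1) ^ CARD('n)) - real k)"
proof -
  interpret prob_space P
    using P by (simp add: poisson_process_law_def)
  let ?x = "diag_point g :: real^'n"
  \<comment> \<open>The coordinate bound from \<open>simplex_grid_point\<close>. With 0 included,
    each coordinate takes \<open>N + 1\<close> values.\<close>
  define N where "N = nat \<lfloor>real CARD('n) * (s + 1)\<rfloor>"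
  define v where "v f = (\<chi> j. real (f j) / real CARD('n) :: real^'n)" for f
  define F where "F = {f \<in> UNIV \<rightarrow>\<^sub>E {..N}. coord_sum (v f) \<ge> s}"
  define B where "B f = {z. dominated (?x - v f) z}" for f
  define A where "A = {y. dominated y ?x \<and> g - coord_sum y < s + 1}"
  define V where "V f = {S \<in> space P. S \<inter> B f = {}}" for f
  define E where "E = {S \<in> space P. of_nat k \<le> num_points (S \<inter> A)}"
  have finF: "finite F"
    unfolding F_def by (intro finite_subset[OF _ finite_PiE[of UNIV "\<lambda>_. {..N}"]]) auto
  have cardF: "real (card F) \<le> (real CARD('n) * (s + 1) + 1) ^ CARD('n)"
  proof -
    have "card F \<le> card (UNIV \<rightarrow>\<^sub>E {..N} :: ('n \<Rightarrow> nat) set)"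
      unfolding F_def by (intro card_mono finite_PiE) auto
    also have "\<dots> = (N + 1) ^ CARD('n)"
      by (simp add: card_PiE)
    finally have "real (card F) \<le> (real N + 1) ^ CARD('n)"
      by (metis of_nat_1 of_nat_add of_nat_le_iff of_nat_power)
    also have "\<dots> \<le> (real CARD('n) * (s + 1) + 1) ^ CARD('n)"
      unfolding N_def using s(1) by (intro power_mono) auto
    finally show ?thesis .
  qed
  have B: "B f \<in> sets borel" for f
    unfolding B_def by measurable
  have Bmeas: "emeasure (intensity g) (B f) = ennreal (exp (- g) * (exp (coord_sum (v f)) - 1))" for f
    unfolding B_def by (rule emeasure_intensity_shifted_orthant) (simp add: v_def)
  have vnn: "coord_sum (v f) \<ge> 0" for f
    by (simp add: coord_sum_def v_def sum_nonneg)
  note void = poisson_process_void_eq[OF P B Bmeas, folded V_def]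
  have V: "V f \<in> events" "prob (V f) \<le> exp (- R)" if "f \<in> F" for f
  proof -
    show "V f \<in> events"
      using void(1) vnn by simp
    have "R \<le> exp (- g) * (exp (coord_sum (v f)) - 1)"
      using s(2) that by (elim order_trans) (auto simp: F_def)
    then show "prob (V f) \<le> exp (- R)"
      using void(2)[of f] vnn[of f] by simp
  qed
  have A: "A \<in> sets borel"
    unfolding A_def by measurable
  have Ameas: "emeasure (intensity g) A \<le> ennreal (exp (s + 1 - g) * (s + 1) ^ CARD('n))"
    unfolding A_def using s(1) by (intro emeasure_intensity_simplex_le) simp
  note tail = poisson_process_tail_le[OF P A Ameas, folded E_def]
  have E: "E \<in> events" "prob E \<le> exp (2 * (exp (s + 1 - g) * (s + 1) ^ CARD('n)) - real k)"
    using tail s(1) by (auto simp: E_def)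
  have incl: "{S \<in> space P. of_nat k \<le> num_dominated_maxima g S} \<subseteq> (\<Union>f\<in>F. V f) \<union> E"
  proof
    fix S assume S: "S \<in> {S \<in> space P. of_nat k \<le> num_dominated_maxima g S}"
    show "S \<in> (\<Union>f\<in>F. V f) \<union> E"
    proof (rule ccontr)
      assume not: "S \<notin> (\<Union>f\<in>F. V f) \<union> E"
      have "{y \<in> maxima S. dominated y ?x} \<subseteq> S \<inter> A"
      proof clarify
        fix y assume y: "y \<in> maxima S" "dominated y ?x"
        have "y \<in> A"
        proof (rule ccontr)
          assume "y \<notin> A"
          with y have "coord_sum (?x - y) \<ge> s + 1"
            by (simp add: A_def coord_sum_diag_point_minus)
          moreover have "(?x - y) $ j \<ge> 0" for j
            using y by (simp add: dominated_def less_imp_le)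
          ultimately obtain f where f: "\<And>j. f j \<le> N" "\<And>j. v f $ j \<le> (?x - y) $ j" "coord_sum (v f) \<ge> s"
            using simplex_grid_point[of "?x - y" s] s(1) by (auto simp: N_def v_def)
          then have "f \<in> F"
            by (simp add: F_def PiE_UNIV_domain)
          with not S obtain z where z: "z \<in> S" "dominated (?x - v f) z"
            by (auto simp: V_def B_def)
          \<comment> \<open>\<open>y\<close> is weakly below the corner \<open>?x - v f\<close>,
            because \<open>v f\<close> was rounded down, and \<open>z\<close> is strictly above
            it.\<close>
          have "dominated y z"
            using z(2) f(2) by (auto simp: dominated_def) (smt (verit))
          with y(1) z(1) show False
            by (auto simp: maxima_def)
        qed
        with y(1) show "y \<in> S \<inter> A"
          by (auto simp: maxima_def)
      qed
      then have "num_dominated_maxima g S \<le> num_points (S \<inter> A)"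
        unfolding num_dominated_maxima_def num_points_def by (intro emeasure_mono) auto
      with S not show False
        by (auto simp: E_def)
    qed
  qed
  \<comment> \<open>Monotonicity rests on measurability of the larger event; a nonmeasurable smaller
    one would have \<open>measure\<close> 0 by convention.\<close>
  have "measure P {S \<in> space P. of_nat k \<le> num_dominated_maxima g S} \<le> prob ((\<Union>f\<in>F. V f) \<union> E)"
    using incl V E finF by (intro finite_measure_mono) auto
  also have "\<dots> \<le> prob (\<Union>f\<in>F. V f) + prob E"
    using V E finF by (intro measure_Un_le) auto
  also have "prob (\<Union>f\<in>F. V f) \<le> (\<Sum>f\<in>F. prob (V f))"
    using V finF by (intro finite_measure_subadditive_finite) auto
  also have "\<dots> \<le> real (card F) * exp (- R)"
    using V(2) by (intro sum_bounded_above) auto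
  also have "\<dots> \<le> (real CARD('n) * (s + 1) + 1) ^ CARD('n) * exp (- R)"
    using cardF by (intro mult_right_mono) auto
  finally show ?thesis
    using E(2) by simp
qed

section \<open>Choice of parameters and asymptotics\<close>

text \<open>On the window for \<open>g\<close>, the upper end \<open>T\<close> yields
  \<open>s \<le> 2 * T\<close> and the lower end \<open>- ln T\<close> yields
  \<open>exp (- g) \<le> T\<close>. The summand 3 collects the two Gumbel tails and the Poisson
  tail, each at most \<open>exp (- T)\<close>.\<close>

lemma K_tail_le:
  fixes P :: "real \<Rightarrow> (real^'n) set measure"
  assumes P: "\<And>g. poisson_process_law (intensity g) (P g)" and T: "T \<ge> 1"
    and k: "24 * 3 ^ CARD('n) * T ^ (CARD('n) + 1) \<le> real k"
  shows "K_tail P k \<le> (3 + (real CARD('n) * (1 + 2 * T) + 1) ^ CARD('n)) * exp (- T)"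
proof -
  let ?d = "CARD('n)"
  define q where "q = (real ?d * (1 + 2 * T) + 1) ^ ?d * exp (- T) + exp (- T)"
  have bound: "measure (P g) {S \<in> space (P g). of_nat k \<le> num_dominated_maxima g S} \<le> q"
    if g: "- ln T \<le> g" "g \<le> T" for g
  proof -
    define s where "s = ln (1 + T * exp g)"
    have s: "exp s = 1 + T * exp g"
      using T by (simp add: s_def add_pos_pos)
    have "1 + T * exp g \<le> exp T * exp T"
    proof -
      have "1 + T * exp g \<le> 1 * exp T + T * exp T"
        using T g by (intro add_mono mult_left_mono) auto
      also have "\<dots> = (1 + T) * exp T"
        by (simp add: algebra_simps)
      also have "\<dots> \<le> exp T * exp T"
        by (intro mult_right_mono exp_ge_add_one_self) auto
      finally show ?thesis .
    qed
    with s have "exp s \<le> exp (2 * T)"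
      by (simp flip: exp_add)
    then have sT: "s \<le> 2 * T"
      by simp
    have s0: "s \<ge> 0"
      using T by (simp add: s_def)
    have "exp (- g) * (exp s - 1) = T"
      by (simp add: s flip: exp_add)
    with s0 have "measure (P g) {S \<in> space (P g). of_nat k \<le> num_dominated_maxima g S}
      \<le> (real ?d * (s + 1) + 1) ^ ?d * exp (- T) + exp (2 * (exp (s + 1 - g) * (s + 1) ^ ?d) - real k)"
      by (intro prob_dominated_maxima_le[OF P]) auto
    also have "(real ?d * (s + 1) + 1) ^ ?d * exp (- T) \<le> (real ?d * (1 + 2 * T) + 1) ^ ?d * exp (- T)"
      using s0 sT by (intro mult_right_mono power_mono add_right_mono mult_left_mono) auto
    also have "exp (2 * (exp (s + 1 - g) * (s + 1) ^ ?d) - real k) \<le> exp (- T)"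
    proof -
      have "exp (- g) \<le> exp (ln T)"
        using g by (subst exp_le_cancel_iff) simp
      then have "exp (- g) \<le> T"
        using T by simp
      moreover have "exp (s + 1 - g) = exp 1 * (exp (- g) + T)"
        by (simp add: exp_add exp_diff s exp_minus field_simps)
      ultimately have "exp (s + 1 - g) \<le> 3 * (T + T)"
        using exp_le T by (intro ord_eq_le_trans[OF _ mult_mono]) auto
      moreover have "(s + 1) ^ ?d \<le> (3 * T) ^ ?d"
        using s0 sT T by (intro power_mono) auto
      ultimately have "exp (s + 1 - g) * (s + 1) ^ ?d \<le> 3 * (T + T) * (3 * T) ^ ?d"
        using s0 T by (intro mult_mono) auto
      also have "\<dots> = 6 * 3 ^ ?d * T ^ (?d + 1)"
        by (simp add: power_mult_distrib)
      \<comment> \<open>Twice the mean is at most \<open>12 * 3 ^ d * T ^ (d + 1)\<close>, half the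
        left side of the assumption on \<open>k\<close>; hence the constant 24. The power of 3 stems
        from \<open>s + 1 \<le> 3 * T\<close>.\<close>
      finally have *: "2 * (exp (s + 1 - g) * (s + 1) ^ ?d) \<le> real k / 2"
        using k by simp
      have "1 * T \<le> 3 ^ ?d * T ^ (?d + 1)"
        using T self_le_power[of T "?d + 1"] by (intro mult_mono) auto
      with k T have "T \<le> real k / 2"
        by linarith
      with * show ?thesis
        by simp
    qed
    finally show ?thesis
      by (simp add: q_def)
  qed
  have q0: "q \<ge> 0"
    using T by (auto simp: q_def intro!: add_nonneg_nonneg mult_nonneg_nonneg)
  have "measure (P g) A \<le> 1" for g A
    using P[of g] by (auto simp: poisson_process_law_def intro!: prob_space.prob_le_1)
  then have "K_tail P k \<le> exp (- exp (- (- ln T))) + exp (- T) + q"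
    unfolding K_tail_def using bound q0 by (intro gumbel_mixture_le) auto
  also have "\<dots> = (3 + (real ?d * (1 + 2 * T) + 1) ^ ?d) * exp (- T)"
    using T by (simp add: q_def algebra_simps)
  finally show ?thesis .
qed

theorem theorem4p4:
  assumes "CARD('n::finite) \<ge> 2"
  shows "\<exists>c::real. c > 0 \<and> (\<exists>k0::nat. \<forall>P :: real \<Rightarrow> (real^'n) set measure.
           (\<forall>g. poisson_process_law (intensity g) (P g)) \<longrightarrow>
           (\<forall>k\<ge>k0. K_tail P k \<le>
              exp (- c * real k powr
                (1 / (real CARD('n) + 2 - 1 / (real CARD('n) - 1))))))"
proof -
  let ?d = "CARD('n)"
  define D where "D = real ?d + 2 - 1 / (real ?d - 1)"
  \<comment> \<open>Since \<open>d \<ge> 2\<close>, the subtracted fraction is at most 1. This makes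
    \<open>(k powr (1 / D)) ^ (d + 1)\<close> at most \<open>k\<close>.\<close>
  have D: "D \<ge> real ?d + 1"
    using assms by (simp add: D_def divide_le_eq)
  \<comment> \<open>The divisor 72 ensures \<open>24 * 3 ^ d \<le> 72 ^ (d + 1)\<close> for every
    \<open>d\<close>.\<close>
  define T where "T k = real k powr (1 / D) / 72" for k
  have "filterlim T at_top at_top"
    unfolding T_def using D by real_asymp
  \<comment> \<open>Half of the exponent absorbs the polynomial factor, whence the final constant
    \<open>1 / 144\<close>.\<close>
  moreover have "eventually (\<lambda>t. (3 + (real ?d * (1 + 2 * t) + 1) ^ ?d) * exp (- t) \<le> exp (- t / 2)) at_top"
    using zero_less_card_finite[where 'a = 'n] unfolding of_nat_0_less_iff[symmetric, where 'a = real]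
    by real_asymp
  ultimately have "eventually (\<lambda>k. T k \<ge> 1 \<and>
      (3 + (real ?d * (1 + 2 * T k) + 1) ^ ?d) * exp (- T k) \<le> exp (- T k / 2)) at_top"
    by (intro eventually_conj) (auto simp: filterlim_at_top dest: eventually_compose_filterlim)
  then obtain k0 where k0: "\<And>k. k \<ge> k0 \<Longrightarrow> T k \<ge> 1"
    "\<And>k. k \<ge> k0 \<Longrightarrow> (3 + (real ?d * (1 + 2 * T k) + 1) ^ ?d) * exp (- T k) \<le> exp (- T k / 2)"
    by (auto simp: eventually_at_top_linorder)
  have "K_tail P k \<le> exp (- (1 / 144) * real k powr (1 / D))"
    if P: "\<And>g. poisson_process_law (intensity g) (P g)" and k: "k \<ge> k0"
    for P :: "real \<Rightarrow> (real^'n) set measure" and k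
  proof -
    have T: "T k \<ge> 1"
      by (rule k0(1)[OF k])
    \<comment> \<open>\<open>0 powr (1 / D)\<close> is 0, so \<open>k = 0\<close> would give
      \<open>T k = 0\<close>.\<close>
    then have "k > 0"
      by (cases k) (auto simp: T_def)
    have "(real k powr (1 / D)) ^ (?d + 1) = real k powr (real (?d + 1) / D)"
      using \<open>k > 0\<close> by (subst powr_power) auto
    also have "\<dots> \<le> real k powr 1"
      using D \<open>k > 0\<close> by (intro powr_mono) auto
    finally have "(real k powr (1 / D)) ^ (?d + 1) \<le> real k"
      by simp
    moreover have "(24 :: real) * 3 ^ ?d \<le> 72 * 72 ^ ?d"
      by (intro mult_mono power_mono) auto
    ultimately have "24 * 3 ^ ?d * (real k powr (1 / D)) ^ (?d + 1) \<le> 72 ^ (?d + 1) * real k"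
      by (intro mult_mono) auto
    then have "24 * 3 ^ ?d * T k ^ (?d + 1) \<le> real k"
      by (simp add: T_def power_divide field_simps)
    from K_tail_le[OF P T this] k0(2)[OF k] show ?thesis
      by (simp add: T_def)
  qed
  then show ?thesis
    unfolding D_def[symmetric] by (intro exI[of _ "1 / 144"] conjI exI[of _ k0]) auto
qed

end
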